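(* Let $b\in W$ be the element determined by the recursion relation $b=(b,b\sigma)\,\sigma$. Then the power series $\Phi_b$ is not a rational function of $(X,Y)$.
   Context: Let $T$ be the infinite rooted regular binary tree whose vertices are the finite words over $\{0,1\}$, with root the empty word, each word $t$ being joined by an edge to the words $0t$ and $1t$. Level $n$ of $T$ is the set of words of length $n$. Let $W=\mathrm{Aut}(T)$ be the automorphism group of $T$ (products are compositions, $(uv)(t)=u(v(t))$). For $u,v\in W$, let $(u,v)\in W$ be the automorphism fixing the root and given by $t0\mapsto u(t)0$ and $t1\mapsto v(t)1$ for every word $t$. Let $\sigma\in W$ be the involution fixing the root with $t0\mapsto t1$ and $t1\mapsto t0$ for every word $t$. For $w\in W$, every orbit of $w$ on level $n$ has length $2^m$ for some $0\le m\le n$. The orbit length generating function of $w$ is $\Phi_w=\sum_{n\ge m\ge 0}o_{m,n}(w)X^mY^n\in 1+Y\mathbb{Z}[[X,Y]]$, where $o_{m,n}(w)$ is the number of orbits of $w$ of length $2^m$ on level $n$. *)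

theory Defs
  imports
    "HOL-Combinatorics.Orbits"
    "HOL-Computational_Algebra.Polynomial_FPS"
begin

section \<open>The binary tree and its automorphism group\<close>

text \<open>
  A word over \<open>{0,1}\<close> is a \<^typ>\<open>bool list\<close>, with \<^term>\<open>False\<close> for the letter \<open>0\<close> and
  \<^term>\<open>True\<close> for \<open>1\<close>, written in the usual left-to-right order. The children of \<open>t\<close> are
  \<open>0t\<close> and \<open>1t\<close>, so the tree grows at the head of the list: the last letter of a
  word selects the branch at the root, and \<^const>\<open>tl\<close> is the parent map.
\<close>

type_synonym vertex = "bool list"

definition adjacent :: "vertex \<Rightarrow> vertex \<Rightarrow> bool" where
  "adjacent s t \<longleftrightarrow> (\<exists>x. s = x # t) \<or> (\<exists>x. t = x # s)"

definition W :: "(vertex \<Rightarrow> vertex) set" where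
  "W = {w. bij w \<and> w [] = [] \<and> (\<forall>s t. adjacent (w s) (w t) \<longleftrightarrow> adjacent s t)}"

definition pair :: "(vertex \<Rightarrow> vertex) \<Rightarrow> (vertex \<Rightarrow> vertex) \<Rightarrow> vertex \<Rightarrow> vertex" where
  "pair u v t = (if t = [] then []
                 else if last t then v (butlast t) @ [True] else u (butlast t) @ [False])"

definition \<sigma> :: "vertex \<Rightarrow> vertex" where
  "\<sigma> t = (if t = [] then [] else butlast t @ [\<not> last t])"

lemma pair_simps [simp]:
  "pair u v [] = []"
  "pair u v (t @ [False]) = u t @ [False]"
  "pair u v (t @ [True]) = v t @ [True]"
  by (simp_all add: pair_def)

lemma \<sigma>_simps [simp]:
  "\<sigma> [] = []"
  "\<sigma> (t @ [False]) = t @ [True]"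
  "\<sigma> (t @ [True]) = t @ [False]"
  by (simp_all add: \<sigma>_def)


section \<open>Orbit length generating functions\<close>

text \<open>
  For a permutation with finite orbits, such as a tree automorphism, the forward
  orbit \<^const>\<open>orbit\<close> coincides with the orbit of the cyclic group it generates.
\<close>

definition orbit_number :: "(vertex \<Rightarrow> vertex) \<Rightarrow> nat \<Rightarrow> nat \<Rightarrow> nat" where
  "orbit_number w m n = card {A. (\<exists>t. length t = n \<and> A = orbit w t) \<and> card A = 2 ^ m}"

text \<open>
  \<open>\<int>[[X,Y]]\<close> is represented as \<open>\<int>[[X]][[Y]]\<close>: the outer variable is \<open>Y\<close> and the inner
  one is \<open>X\<close>. The same convention applies to polynomials.
\<close>

definition orbit_gf :: "(vertex \<Rightarrow> vertex) \<Rightarrow> int fps fps" where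
  "orbit_gf w = Abs_fps (\<lambda>n. Abs_fps (\<lambda>m. if m \<le> n then int (orbit_number w m n) else 0))"

definition fps2_of_poly2 :: "int poly poly \<Rightarrow> int fps fps" where
  "fps2_of_poly2 P = fps_of_poly (map_poly fps_of_poly P)"

text \<open>
  \<open>F = P / Q\<close> with \<open>P, Q\<close> polynomials in \<open>X, Y\<close> and \<open>Q \<noteq> 0\<close>; since \<open>\<int>[[X,Y]]\<close> is an
  integral domain this is expressed as \<open>Q F = P\<close>. Clearing denominators, integer
  coefficients of \<open>P\<close> and \<open>Q\<close> give the same notion as rational ones.
\<close>

definition rational_function :: "int fps fps \<Rightarrow> bool" where
  "rational_function F \<longleftrightarrow>
     (\<exists>P Q. Q \<noteq> 0 \<and> fps2_of_poly2 Q * F = fps2_of_poly2 P)"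


section \<open>The recursion has exactly one solution\<close>

lemma length_\<sigma> [simp]: "length (\<sigma> t) = length t"
  by (simp add: \<sigma>_def)

lemma \<sigma>_\<sigma> [simp]: "\<sigma> (\<sigma> t) = t"
  by (cases t rule: rev_cases) (simp_all add: \<sigma>_def)

lemma \<sigma>_eq_iff [simp]: "\<sigma> s = \<sigma> t \<longleftrightarrow> s = t"
  by (metis \<sigma>_\<sigma>)

function rec_sol :: "vertex \<Rightarrow> vertex" where
  "rec_sol t = (if t = [] then []
                else if last t then rec_sol (butlast t) @ [False]
                else rec_sol (\<sigma> (butlast t)) @ [True])"
  by auto
termination by (relation "measure length") auto

declare rec_sol.simps [simp del]

lemma rec_sol_simps [simp]:
  "rec_sol [] = []"
  "rec_sol (t @ [True]) = rec_sol t @ [False]"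
  "rec_sol (t @ [False]) = rec_sol (\<sigma> t) @ [True]"
  by (subst rec_sol.simps; simp)+

lemma rec_sol_single: "rec_sol [a] = [\<not> a]"
  using rec_sol_simps(2,3)[of "[]"] by (cases a) simp_all

lemma tl_\<sigma>: "tl (\<sigma> t) = \<sigma> (tl t)"
  by (cases t) (auto simp: \<sigma>_def)

lemma length_rec_sol [simp]: "length (rec_sol t) = length t"
proof (induction "length t" arbitrary: t)
  case (Suc n)
  then obtain s a where "t = s @ [a]" by (cases t rule: rev_cases) auto
  with Suc show ?case by (cases a) auto
qed simp

lemma rec_sol_eq_Nil [simp]: "rec_sol t = [] \<longleftrightarrow> t = []"
  by (metis length_0_conv length_rec_sol)

lemma \<sigma>_eq_Nil [simp]: "\<sigma> t = [] \<longleftrightarrow> t = []"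
  by (simp add: \<sigma>_def)

lemma tl_rec_sol: "tl (rec_sol t) = rec_sol (tl t)"
proof (induction "length t" arbitrary: t)
  case (Suc n)
  then obtain s a where t: "t = s @ [a]" by (cases t rule: rev_cases) auto
  with Suc have "length s = n" by simp
  with Suc.hyps(1)[of s] Suc.hyps(1)[of "\<sigma> s"] t show ?case
    by (cases a; cases "s = []") (auto simp: tl_\<sigma> tl_append2 rec_sol_single)
qed simp

lemma inj_rec_sol: "inj rec_sol"
proof (rule injI)
  fix s t assume "rec_sol s = rec_sol t"
  then show "s = t"
  proof (induction "length s" arbitrary: s t)
    case 0
    then have "length s = 0" "length t = 0" using length_rec_sol[of s] length_rec_sol[of t] by simp_all
    then show ?case by simp
  next
    case (Suc n)
    then have "length t = Suc n" by (metis length_rec_sol)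
    with Suc.hyps(2) obtain s' a t' c where st: "s = s' @ [a]" "t = t' @ [c]"
      by (cases s rule: rev_cases; cases t rule: rev_cases) auto
    with Suc.hyps(2) have "n = length s'" "n = length (\<sigma> s')" by simp_all
    then have "rec_sol s' = rec_sol t' \<Longrightarrow> s' = t'"
      "rec_sol (\<sigma> s') = rec_sol (\<sigma> t') \<Longrightarrow> \<sigma> s' = \<sigma> t'"
      using Suc.hyps(1) by blast+
    with Suc.prems st show ?case
      by (cases a; cases c) auto
  qed
qed

lemma surj_rec_sol: "surj rec_sol"
proof -
  have "\<exists>s. rec_sol s = t" for t
  proof (induction t rule: rev_induct)
    case (snoc a t)
    then obtain s where "rec_sol s = t" by blast
    then have "rec_sol (s @ [True]) = t @ [False]" "rec_sol (\<sigma> s @ [False]) = t @ [True]"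
      by simp_all
    then show ?case by (cases a) (simp_all only: , blast+)
  qed (metis rec_sol_simps(1))
  then show ?thesis unfolding surj_def by (metis (lifting))
qed

lemma adjacent_iff_tl: "adjacent s t \<longleftrightarrow> (s \<noteq> [] \<and> tl s = t) \<or> (t \<noteq> [] \<and> tl t = s)"
  unfolding adjacent_def by (cases s; cases t) auto

lemma rec_sol_in_W: "rec_sol \<in> W"
  using inj_rec_sol surj_rec_sol
  by (auto simp: W_def bij_def adjacent_iff_tl tl_rec_sol inj_eq)

lemma rec_sol_recursion: "rec_sol = pair rec_sol (rec_sol \<circ> \<sigma>) \<circ> \<sigma>"
proof
  fix t show "rec_sol t = (pair rec_sol (rec_sol \<circ> \<sigma>) \<circ> \<sigma>) t"
  proof (cases t rule: rev_cases)
    case (snoc s a)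
    then show ?thesis by (cases a) auto
  qed simp
qed

lemma recursion_unique:
  assumes "b = pair b (b \<circ> \<sigma>) \<circ> \<sigma>"
  shows "b = rec_sol"
proof
  fix t show "b t = rec_sol t"
  proof (induction "length t" arbitrary: t)
    case 0
    have "b [] = (pair b (b \<circ> \<sigma>) \<circ> \<sigma>) []" using assms by metis
    with 0 show ?case by simp
  next
    case (Suc n)
    then obtain s a where t: "t = s @ [a]" by (cases t rule: rev_cases) auto
    have "b t = (pair b (b \<circ> \<sigma>) \<circ> \<sigma>) t" using assms by metis
    with Suc t show ?case by (cases a) auto
  qed
qed

lemma ex1_recursion: "\<exists>!b. b \<in> W \<and> b = pair b (b \<circ> \<sigma>) \<circ> \<sigma>"
  using rec_sol_in_W rec_sol_recursion recursion_unique by blast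

end

theory Submission
  imports Defs "HOL-Library.Z2" "HOL-Library.Log_Nat"
begin

text \<open>
  Reading a word from its last letter as the coefficients of a polynomial \<open>f\<close> over \<open>\<bbbF>\<^sub>2\<close>, the
  recursion makes \<open>b\<close> act on level \<open>n\<close> by the affine map \<open>f \<mapsto> f / (1 + x) + 1 / (1 + x)\<^sup>2\<close>
  modulo \<open>x\<^sup>n\<close>. Its fixed point \<open>1 / (x (1 + x))\<close> is not a power series, but after moving it to
  the origin and rescaling by \<open>x\<close>, \<open>b\<close> becomes multiplication by \<open>(1 + x)\<^sup>-\<^sup>1\<close> on the units of
  \<open>\<bbbF>\<^sub>2[x] / x\<^bsup>n+1\<^esup>\<close>. So all orbits on level \<open>n\<close> have the same length, the order of \<open>1 + x\<close>, which is
  the least \<open>2\<^sup>m > n\<close>. Hence \<open>(1 - 2 Y) \<Phi>\<^sub>b\<close> is lacunary in \<open>Y\<close>, with nonzero coefficients exactly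
  at \<open>0\<close> and at the powers of \<open>2\<close>, and cannot be rational.
\<close>

section \<open>Orbits of power of two length\<close>

text \<open>Euclid's algorithm on exponents: once \<open>f ^^ n\<close> fixes \<open>x\<close>, the
  exponent \<open>m\<close> may be reduced modulo \<open>n\<close>.\<close>

lemma funpow_gcd_fixed:
  assumes "(f ^^ m) x = x" "(f ^^ n) x = x"
  shows "(f ^^ gcd m n) x = x"
  using assms
proof (induction m n rule: gcd_nat_induct)
  case (step m n)
  then have "(f ^^ (m mod n)) x = x" by (simp add: funpow_mod_eq)
  with step have "(f ^^ gcd n (m mod n)) x = x" by blast
  then show ?case by (metis gcd_red_nat)
qed simp

text \<open>The least period divides \<open>2 ^ m\<close>, so it is a power of two; a proper one
  would divide \<open>2 ^ (m - 1)\<close>. Testing two exponents is thus enough.\<close>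

lemma card_orbit_power2:
  assumes fixed: "(f ^^ 2 ^ m) x = x"
    and minimal: "m > 0 \<Longrightarrow> (f ^^ 2 ^ (m - 1)) x \<noteq> x"
  shows "card (orbit f x) = 2 ^ m"
proof -
  have self: "x \<in> orbit f x"
    using fixed unfolding orbit_altdef by (metis (mono_tags, lifting) mem_Collect_eq pos2 zero_less_power)
  define p where "p = funpow_dist1 f x x"
  have p: "(f ^^ p) x = x" "p > 0"
    using funpow_dist1_prop[OF self] by (simp_all add: p_def)
  have "gcd p (2 ^ m) \<ge> p"
  proof (rule ccontr)
    assume "\<not> ?thesis"
    moreover have "(f ^^ gcd p (2 ^ m)) x = x" using funpow_gcd_fixed p(1) fixed .
    ultimately show False
      using funpow_dist1_least[of "gcd p (2 ^ m)" f x x] p(2) by (simp add: p_def)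
  qed
  then have "p dvd 2 ^ m" using p(2) by (metis dvd_imp_le gcd_dvd1 gcd_dvd2 le_antisym)
  then obtain k where k: "k \<le> m" "p = 2 ^ k" by (metis divides_primepow_nat two_is_prime_nat)
  have "k = m"
  proof (rule ccontr)
    assume "k \<noteq> m"
    with k have "m > 0" "p dvd 2 ^ (m - 1)" by (auto simp: le_imp_power_dvd)
    moreover from this obtain c where "2 ^ (m - 1) = p * c" by (auto elim: dvdE)
    moreover have "((f ^^ p) ^^ c) x = x" using p(1) by (induction c) auto
    ultimately show False using minimal by (simp add: funpow_mult mult.commute)
  qed
  moreover have "card (orbit f x) = p"
    using inj_on_funpow_dist1[OF self] orbit_conv_funpow_dist1[OF self]
    by (simp add: card_image p_def)
  ultimately show ?thesis using k by simp
qed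

lemma orbit_number_uniform:
  assumes len: "\<And>t. length (w t) = length t"
    and self: "\<And>t. t \<in> orbit w t"
    and card: "\<And>t. length t = n \<Longrightarrow> card (orbit w t) = 2 ^ m"
  shows "2 ^ m * orbit_number w m n = 2 ^ n" and "k \<noteq> m \<Longrightarrow> orbit_number w k n = 0"
proof -
  define C where "C = {A. \<exists>t. length t = n \<and> A = orbit w t}"
  define L where "L = {t :: vertex. length t = n}"
  have L: "finite L" "card L = 2 ^ n"
    using finite_lists_length_eq[of "UNIV :: bool set" n] card_lists_length_eq[of "UNIV :: bool set" n]
    by (simp_all add: L_def)
  have len_orbit: "s \<in> orbit w t \<Longrightarrow> length s = length t" for s t
    by (induction rule: orbit.induct) (simp_all add: len)
  have un: "\<Union>C = L" using self len_orbit unfolding C_def L_def by blast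
  have "C = orbit w ` L" by (auto simp: C_def L_def)
  then have "finite C" using L by simp
  \<comment> \<open>Forward orbits may overlap in general; \<open>self\<close> makes them cyclic,
    hence equal or disjoint.\<close>
  moreover have "A \<inter> B = {}" if "A \<in> C" "B \<in> C" "A \<noteq> B" for A B
  proof -
    have "cyclic_on w A" "cyclic_on w B"
      using that self by (auto simp: C_def intro: cyclic_on_singleI)
    then show ?thesis using that(3) by (metis disjoint_iff orbit_cyclic_eq3)
  qed
  moreover have "\<forall>A\<in>C. card A = 2 ^ m" using card by (auto simp: C_def)
  ultimately have "2 ^ m * card C = card L"
    using card_partition[of C "2 ^ m"] un L(1) by metis
  moreover have "{A. (\<exists>t. length t = n \<and> A = orbit w t) \<and> card A = 2 ^ m} = C"
    using card by (auto simp: C_def)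
  ultimately show "2 ^ m * orbit_number w m n = 2 ^ n"
    by (simp add: orbit_number_def L)
  show "orbit_number w k n = 0" if "k \<noteq> m"
  proof -
    have "{A. (\<exists>t. length t = n \<and> A = orbit w t) \<and> card A = 2 ^ k} = {}"
      using card that by auto
    then show ?thesis unfolding orbit_number_def by (simp only: card.empty)
  qed
qed

section \<open>The action as multiplication in characteristic two\<close>

lemma bit_fps_2: "(2 :: bit fps) = 0"
  by (simp add: numeral_fps_const)

lemma bit_fps_double: "f + f = (0 :: bit fps)"
  by (simp add: bit_fps_2 flip: mult_2)

lemma bit_fps_one_plus_power2: "(1 + f :: bit fps) ^ 2 ^ m = 1 + f ^ 2 ^ m"
proof (induction m)
  case (Suc m)
  have "(1 + f) ^ 2 ^ Suc m = (1 + f ^ 2 ^ m) * (1 + f ^ 2 ^ m)"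
    by (simp only: power_Suc2 power_mult Suc power2_eq_square)
  also have "\<dots> = 1 + (f ^ 2 ^ m + f ^ 2 ^ m) + f ^ 2 ^ m * f ^ 2 ^ m"
    by (simp add: algebra_simps)
  also have "\<dots> = 1 + f ^ 2 ^ Suc m"
    by (simp add: bit_fps_double mult_2 power_add)
  finally show ?case .
qed simp

text \<open>\<open>rev\<close> makes the letter at the root the constant term, so descending to a
  branch strips one factor \<open>fps_X\<close>. Series are used so that \<open>1 + fps_X\<close> is
  invertible.\<close>

definition word_fps :: "vertex \<Rightarrow> bit fps" where
  "word_fps t = fps_of_poly (Poly (map of_bool (rev t)))"

lemma word_fps_simps [simp]:
  "word_fps [] = 0"
  "word_fps (t @ [a]) = of_bool a + fps_X * word_fps t"
  by (cases a; simp add: word_fps_def fps_of_poly_pCons mult.commute)+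

lemma word_fps_eqD:
  assumes "length s = length t" "fps_X ^ length t dvd word_fps s - word_fps t"
  shows "s = t"
  using assms
proof (induction s arbitrary: t rule: rev_induct)
  case (snoc a s)
  then obtain t' c where t: "t = t' @ [c]" by (cases t rule: rev_cases) auto
  obtain q where q: "word_fps (s @ [a]) - word_fps t = fps_X ^ length t * q"
    using snoc.prems(2) by (elim dvdE)
  from arg_cong[OF q, of "\<lambda>f. fps_nth f 0"] have "a = c"
    by (cases a; cases c) (simp_all add: t)
  with q have "fps_X * (word_fps s - word_fps t') = fps_X * (fps_X ^ length t' * q)"
    by (simp add: t algebra_simps)
  then have "fps_X ^ length t' dvd word_fps s - word_fps t'" by simp
  with snoc t \<open>a = c\<close> show ?case by simp
qed simp

text \<open>The difference vanishes exactly except at the empty word, where the divisor is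
  \<open>1\<close>.\<close>

lemma word_fps_\<sigma>: "fps_X ^ length t dvd word_fps (\<sigma> t) - word_fps t - 1"
proof (cases t rule: rev_cases)
  case (snoc s a)
  then have "word_fps (\<sigma> t) - word_fps t - 1 = 0"
    by (cases a) (simp_all add: bit_fps_2 algebra_simps)
  then show ?thesis by simp
qed simp

definition x1_inverse :: "bit fps" where
  "x1_inverse = inverse (1 + fps_X)"

lemma X_mult_x1_inverse: "fps_X * x1_inverse = 1 - x1_inverse"
proof -
  have "(1 + fps_X) * x1_inverse = 1"
    by (simp add: x1_inverse_def inverse_mult_eq_1')
  then show ?thesis by (simp add: algebra_simps eq_diff_eq)
qed

lemma word_fps_rec_sol:
  "fps_X ^ length t dvd (1 + fps_X) * word_fps (rec_sol t) - word_fps t - x1_inverse"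
proof (induction "length t" arbitrary: t)
  case (Suc n)
  then obtain s a where t: "t = s @ [a]" by (cases t rule: rev_cases) auto
  define D where "D r = (1 + fps_X) * word_fps (rec_sol r) - word_fps r - x1_inverse" for r
  define E where "E = word_fps (\<sigma> s) - word_fps s - 1"
  have D: "fps_X ^ n dvd D s" "fps_X ^ n dvd D (\<sigma> s)"
    using Suc.hyps(1)[of s] Suc.hyps(1)[of "\<sigma> s"] Suc.hyps(2) t by (simp_all add: D_def)
  have E: "fps_X ^ n dvd E" using word_fps_\<sigma>[of s] Suc.hyps(2) t by (simp add: E_def)
  \<comment> \<open>Descending to a branch contributes the extra factor \<open>fps_X\<close>; all
    other terms cancel by \<open>X_mult_x1_inverse\<close> and characteristic two.\<close>
  have "D t = (if a then fps_X * D s else fps_X * (D (\<sigma> s) + E))"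
  proof (cases a)
    case True
    have "D t = fps_X * D s + (fps_X * x1_inverse - 1 - x1_inverse)"
      using True by (simp add: t D_def algebra_simps)
    also have "\<dots> = fps_X * D s - (x1_inverse + x1_inverse)"
      by (simp add: X_mult_x1_inverse)
    finally show ?thesis using True by (simp add: bit_fps_double)
  next
    case False
    have "D t = fps_X * (D (\<sigma> s) + E) + (1 + (fps_X + fps_X) + fps_X * x1_inverse - x1_inverse)"
      using False by (simp add: t D_def E_def algebra_simps)
    also have "\<dots> = fps_X * (D (\<sigma> s) + E) + (1 + 1) - (x1_inverse + x1_inverse)"
      by (simp only: X_mult_x1_inverse bit_fps_double) simp
    finally show ?thesis using False by (simp only: bit_fps_double) simp
  qed
  then have "fps_X * fps_X ^ n dvd D t"
    using D E by (auto intro!: mult_dvd_mono dvd_add)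
  then show ?case using Suc.hyps(2) by (simp add: D_def flip: Suc.hyps(2))
qed simp

definition unit_fps :: "vertex \<Rightarrow> bit fps" where
  "unit_fps t = fps_X * word_fps t + x1_inverse"

text \<open>Multiplying the affine congruence by \<open>fps_X\<close> gains one power, hence the
  \<open>Suc\<close>, and turns its constant into \<open>2 * fps_X * x1_inverse = 0\<close>.\<close>

lemma unit_fps_rec_sol:
  "fps_X ^ Suc (length t) dvd (1 + fps_X) * unit_fps (rec_sol t) - unit_fps t"
proof -
  have "(1 + fps_X) * unit_fps (rec_sol t) - unit_fps t =
    fps_X * ((1 + fps_X) * word_fps (rec_sol t) - word_fps t - x1_inverse)
      + (fps_X * x1_inverse + fps_X * x1_inverse)"
    by (simp add: unit_fps_def algebra_simps)
  also have "\<dots> = fps_X * ((1 + fps_X) * word_fps (rec_sol t) - word_fps t - x1_inverse)"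
    by (simp only: bit_fps_double) simp
  finally show ?thesis using word_fps_rec_sol[of t] by (simp add: mult_dvd_mono)
qed

lemma length_funpow_rec_sol [simp]: "length ((rec_sol ^^ k) t) = length t"
  by (induction k) simp_all

lemma unit_fps_funpow_rec_sol:
  "fps_X ^ Suc (length t) dvd (1 + fps_X) ^ k * unit_fps ((rec_sol ^^ k) t) - unit_fps t"
proof (induction k)
  case (Suc k)
  let ?s = "(rec_sol ^^ k) t"
  have "(1 + fps_X) ^ Suc k * unit_fps ((rec_sol ^^ Suc k) t) - unit_fps t =
    (1 + fps_X) ^ k * ((1 + fps_X) * unit_fps (rec_sol ?s) - unit_fps ?s)
      + ((1 + fps_X) ^ k * unit_fps ?s - unit_fps t)"
    by (simp add: algebra_simps)
  moreover have "fps_X ^ Suc (length t) dvd (1 + fps_X) * unit_fps (rec_sol ?s) - unit_fps ?s"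
    using unit_fps_rec_sol[of ?s] by simp
  ultimately show ?case using Suc by (metis dvd_add dvd_mult)
qed simp

lemma unit_fps_is_unit: "unit_fps t dvd 1"
  by (simp add: unit_fps_def x1_inverse_def)

text \<open>Cancelling the unit \<open>unit_fps t\<close> leaves a condition on the length of
  \<open>t\<close> alone, so all orbits on a level have the same size.\<close>

lemma funpow_rec_sol_fixed_iff:
  "(rec_sol ^^ k) t = t \<longleftrightarrow> fps_X ^ Suc (length t) dvd (1 + fps_X :: bit fps) ^ k - 1"
proof
  assume "(rec_sol ^^ k) t = t"
  then have "fps_X ^ Suc (length t) dvd ((1 + fps_X) ^ k - 1) * unit_fps t"
    using unit_fps_funpow_rec_sol[of t k] by (simp add: algebra_simps)
  then show "fps_X ^ Suc (length t) dvd (1 + fps_X :: bit fps) ^ k - 1"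
    using dvd_mult_unit_iff[OF unit_fps_is_unit] by blast
next
  let ?s = "(rec_sol ^^ k) t"
  assume "fps_X ^ Suc (length t) dvd (1 + fps_X :: bit fps) ^ k - 1"
  then have "fps_X ^ Suc (length t) dvd
    ((1 + fps_X) ^ k * unit_fps ?s - unit_fps t) - ((1 + fps_X) ^ k - 1) * unit_fps ?s"
    using unit_fps_funpow_rec_sol by (metis dvd_diff dvd_mult2)
  moreover have "((1 + fps_X) ^ k * unit_fps ?s - unit_fps t) - ((1 + fps_X) ^ k - 1) * unit_fps ?s
    = fps_X * (word_fps ?s - word_fps t)"
    by (simp add: unit_fps_def algebra_simps)
  ultimately have "fps_X ^ length t dvd word_fps ?s - word_fps t" by simp
  then show "?s = t" by (intro word_fps_eqD) simp_all
qed

text \<open>By Frobenius, \<open>(1 + fps_X) ^ 2 ^ m - 1\<close> is the single monomial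
  \<open>fps_X ^ 2 ^ m\<close>.\<close>

lemma funpow_power2_rec_sol_fixed_iff: "(rec_sol ^^ 2 ^ m) t = t \<longleftrightarrow> length t < 2 ^ m"
proof -
  have "fps_X ^ Suc (length t) dvd (fps_X :: bit fps) ^ 2 ^ m \<longleftrightarrow> length t < 2 ^ m"
    by (subst fps_dvd_iff) (simp_all add: Suc_le_eq del: power_Suc)
  then show ?thesis
    by (simp add: funpow_rec_sol_fixed_iff bit_fps_one_plus_power2 del: power_Suc)
qed

section \<open>Orbit counts on each level; \<open>floorlog 2 n\<close> is the least \<open>m\<close>
  with \<open>n < 2 ^ m\<close>\<close>

lemma less_power_floorlog: "n < 2 ^ floorlog 2 n"
  by (rule floorlog_leD) simp_all

lemma self_in_orbit_rec_sol: "t \<in> orbit rec_sol t"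
  using funpow_power2_rec_sol_fixed_iff less_power_floorlog unfolding orbit_altdef
  by (metis (mono_tags, lifting) mem_Collect_eq pos2 zero_less_power)

lemma card_orbit_rec_sol: "card (orbit rec_sol t) = 2 ^ floorlog 2 (length t)"
proof (rule card_orbit_power2)
  show "(rec_sol ^^ 2 ^ floorlog 2 (length t)) t = t"
    by (simp add: funpow_power2_rec_sol_fixed_iff less_power_floorlog)
next
  assume "floorlog 2 (length t) > 0"
  then show "(rec_sol ^^ 2 ^ (floorlog 2 (length t) - 1)) t \<noteq> t"
    using floorlog_geD[of "floorlog 2 (length t)" 2 "length t"]
    by (simp add: funpow_power2_rec_sol_fixed_iff)
qed

text \<open>Keeps \<open>n - floorlog 2 n\<close> untruncated and the nonzero coefficient inside the
  range \<open>m \<le> n\<close> of \<open>orbit_gf\<close>.\<close>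

lemma floorlog_le_self: "floorlog 2 n \<le> n"
  by (rule floorlog_leI) simp_all

lemma orbit_number_rec_sol:
  "orbit_number rec_sol m n = (if m = floorlog 2 n then 2 ^ (n - floorlog 2 n) else 0)"
proof -
  note u = orbit_number_uniform[OF length_rec_sol self_in_orbit_rec_sol, of n "floorlog 2 n"]
  have "2 ^ floorlog 2 n * orbit_number rec_sol (floorlog 2 n) n = 2 ^ n"
    by (rule u(1)) (simp add: card_orbit_rec_sol)
  also have "\<dots> = 2 ^ floorlog 2 n * 2 ^ (n - floorlog 2 n)"
    by (simp add: floorlog_le_self flip: power_add)
  finally have "orbit_number rec_sol (floorlog 2 n) n = 2 ^ (n - floorlog 2 n)" by simp
  moreover have "m \<noteq> floorlog 2 n \<Longrightarrow> orbit_number rec_sol m n = 0"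
    by (rule u(2)) (simp_all add: card_orbit_rec_sol)
  ultimately show ?thesis by simp
qed

section \<open>Lacunary series\<close>

text \<open>The lowest term of \<open>Q\<close> is matched with a term of \<open>F\<close> that
  follows a gap longer than \<open>d\<close>: their product is alone in its degree, which exceeds
  \<open>d\<close>.\<close>

lemma lacunary_times_poly:
  fixes F Q :: "'a :: idom fps"
  assumes gaps: "\<And>d. \<exists>N\<ge>d. fps_nth F N \<noteq> 0 \<and> (\<forall>i\<in>{N - d..<N}. fps_nth F i = 0)"
    and Q: "\<And>i. i > d \<Longrightarrow> fps_nth Q i = 0"
    and QF: "\<And>i. i > d \<Longrightarrow> fps_nth (Q * F) i = 0"
  shows "Q = 0"
proof (rule ccontr)
  assume "Q \<noteq> 0"
  define k where "k = subdegree Q"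
  obtain N where N: "N \<ge> Suc d" "fps_nth F N \<noteq> 0"
    and gap: "\<And>i. i \<in> {N - Suc d..<N} \<Longrightarrow> fps_nth F i = 0"
    using gaps[of "Suc d"] by blast
  have "fps_nth (Q * F) (N + k) = (\<Sum>i=0..N + k. fps_nth Q i * fps_nth F (N + k - i))"
    by (simp add: fps_mult_nth)
  also have "\<dots> = (\<Sum>i\<in>{k}. fps_nth Q i * fps_nth F (N + k - i))"
  proof (intro sum.mono_neutral_right ballI)
    \<comment> \<open>Below \<open>k\<close> and above \<open>d\<close> the coefficient of
      \<open>Q\<close> vanishes; in between, the index of \<open>F\<close> falls into the gap before
      \<open>N\<close>.\<close>
    fix i assume "i \<in> {0..N + k} - {k}"
    then consider "i < k" | "i > d" | "k < i" "i \<le> d" by force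
    then show "fps_nth Q i * fps_nth F (N + k - i) = 0"
    proof cases
      case 3
      with N have "N + k - i \<in> {N - Suc d..<N}" by auto
      then show ?thesis by (simp add: gap)
    qed (auto simp: k_def Q)
  qed auto
  finally show False using QF[of "N + k"] N \<open>Q \<noteq> 0\<close> by (simp add: k_def)
qed

lemma fps2_of_poly2_nth: "fps_nth (fps2_of_poly2 P) n = fps_of_poly (coeff P n)"
  by (simp add: fps2_of_poly2_def coeff_map_poly)

text \<open>From \<open>Q G = P\<close> follows \<open>Q (R G) = P R\<close>, still a polynomial.
  Only degrees in the outer variable matter.\<close>

lemma not_rational_if_lacunary:
  fixes G :: "int fps fps"
  assumes gaps: "\<And>d. \<exists>N\<ge>d. fps_nth (fps2_of_poly2 R * G) N \<noteq> 0 \<and>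
      (\<forall>i\<in>{N - d..<N}. fps_nth (fps2_of_poly2 R * G) i = 0)"
  shows "\<not> rational_function G"
proof
  assume "rational_function G"
  then obtain P Q where Q: "Q \<noteq> 0" and eq: "fps2_of_poly2 Q * G = fps2_of_poly2 P"
    unfolding rational_function_def by blast
  let ?d = "max (degree Q) (degree P + degree R)"
  have "fps2_of_poly2 Q = 0"
  proof (rule lacunary_times_poly[OF gaps, where d = ?d])
    show "fps_nth (fps2_of_poly2 Q) i = 0" if "i > ?d" for i
      using that by (simp add: fps2_of_poly2_nth coeff_eq_0)
    show "fps_nth (fps2_of_poly2 Q * (fps2_of_poly2 R * G)) i = 0" if "i > ?d" for i
    proof -
      have "fps2_of_poly2 Q * (fps2_of_poly2 R * G) = fps2_of_poly2 P * fps2_of_poly2 R"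
        by (simp flip: eq add: mult_ac)
      moreover have "fps_nth (fps2_of_poly2 P) j * fps_nth (fps2_of_poly2 R) (i - j) = 0" for j
      proof (cases "j > degree P")
        case False
        with that have "i - j > degree R" by linarith
        then show ?thesis by (simp add: fps2_of_poly2_nth coeff_eq_0)
      qed (simp add: fps2_of_poly2_nth coeff_eq_0)
      ultimately show ?thesis
        by (simp only: fps_mult_nth[of "fps2_of_poly2 P"] sum.neutral_const)
    qed
  qed
  moreover have "fps_nth (fps2_of_poly2 Q) (degree Q) \<noteq> 0"
    using Q by (simp add: fps2_of_poly2_nth)
  ultimately show False by simp
qed

section \<open>The generating function of \<open>b\<close>\<close>

lemma orbit_gf_rec_sol_nth:
  "fps_nth (orbit_gf rec_sol) n = fps_const (2 ^ (n - floorlog 2 n)) * fps_X ^ floorlog 2 n"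
  by (rule fps_ext) (auto simp: orbit_gf_def orbit_number_rec_sol fps_X_power_nth floorlog_le_self)

lemma floorlog_eqI: "2 ^ m \<le> n \<Longrightarrow> n < 2 ^ Suc m \<Longrightarrow> floorlog 2 n = Suc m"
  by (intro antisym floorlog_leI floorlog_ge_SucI) simp_all

theorem proposition3p9:
  fixes b :: "vertex \<Rightarrow> vertex"
  assumes "b \<in> W"
    and "b = pair b (b \<circ> \<sigma>) \<circ> \<sigma>"
  shows "\<not> rational_function (orbit_gf b)"
proof -
  \<comment> \<open>\<open>R\<close> is \<open>1 - 2 Y\<close>: while \<open>floorlog 2 n\<close> is
    constant, the coefficients of the generating function double at each step.\<close>
  define R :: "int poly poly" where "R = [:1, -2:]"
  define F where "F = fps2_of_poly2 R * orbit_gf rec_sol"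
  have F_Suc: "fps_nth F (Suc n) =
      fps_nth (orbit_gf rec_sol) (Suc n) - 2 * fps_nth (orbit_gf rec_sol) n" for n
    by (simp add: F_def R_def fps2_of_poly2_def fps_of_poly_pCons map_poly_pCons algebra_simps
        fps_of_poly_uminus fps_of_poly_numeral)
  have "\<exists>N\<ge>d. fps_nth F N \<noteq> 0 \<and> (\<forall>i\<in>{N - d..<N}. fps_nth F i = 0)" for d
  proof (intro exI conjI ballI)
    \<comment> \<open>The witness is \<open>N = 2 ^ Suc d\<close>. As \<open>d < 2 ^ d\<close>, each
      \<open>i\<close> in the gap exceeds \<open>2 ^ d\<close>, so \<open>i\<close> and
      \<open>i - 1\<close> have the same \<open>floorlog\<close>.\<close>
    have d: "d < 2 ^ d" by simp
    then show "d \<le> 2 ^ Suc d" unfolding power_Suc by linarith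
    show "fps_nth F i = 0" if "i \<in> {2 ^ Suc d - d..<2 ^ Suc d}" for i
    proof -
      from that d have i: "2 ^ d < i" "i < 2 ^ Suc d"
        unfolding power_Suc atLeastLessThan_iff by linarith+
      then obtain n where n: "i = Suc n" "2 ^ d \<le> n" by (cases i) auto
      with i have "floorlog 2 i = Suc d" "floorlog 2 n = Suc d" by (auto intro!: floorlog_eqI)
      moreover from this have "n - d = Suc (n - Suc d)" using floorlog_le_self[of n] by simp
      ultimately show ?thesis using n
        by (simp add: F_Suc orbit_gf_rec_sol_nth numeral_fps_const mult.assoc flip: fps_const_mult)
    qed
    show "fps_nth F (2 ^ Suc d) \<noteq> 0"
    proof -
      define n where "n = 2 ^ Suc d - (1 :: nat)"
      have n: "Suc n = 2 ^ Suc d" by (simp add: n_def)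
      have "floorlog 2 (Suc n) = Suc (Suc d)" "floorlog 2 n = Suc d"
        unfolding n by (rule floorlog_eqI; simp add: n_def)+
      \<comment> \<open>At a power of two the exponent of \<open>X\<close> jumps to
        \<open>Suc (Suc d)\<close>, so at exponent \<open>Suc d\<close> only the term from
        \<open>n\<close> survives.\<close>
      then have "fps_nth (fps_nth F (Suc n)) (Suc d) = - 2 * 2 ^ (n - Suc d)"
        by (simp add: F_Suc orbit_gf_rec_sol_nth numeral_fps_const fps_X_power_nth del: power_Suc)
      then show ?thesis unfolding n by fastforce
    qed
  qed
  then have "\<not> rational_function (orbit_gf rec_sol)"
    unfolding F_def by (rule not_rational_if_lacunary)
  with recursion_unique[OF assms(2)] show ?thesis by simp
qed

end
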